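(* Let $v$ be any pattern and let $r\in\mathbb{N}_0$. Then for every $n\in\mathbb{N}$, $$f_r^v(\mathcal{S}_n)=\sum_{k=1}^{n}(-1)^{n-k}\binom{n}{k}f_r^v([k]^n).$$ Furthermore, let $$S_r^v(x)=\sum_{n=1}^\infty\frac{f_r^v(\mathcal{S}_n)}{n!}x^n\qquad\text{and}\qquad W_{r,k}^v(x)=\sum_{n=1}^\infty\frac{f_r^v([k]^n)}{n!}x^n,\quad k\in\mathbb{N},$$ be the exponential generating functions of $f_r^v(\mathcal{S}_n)$ and $f_r^v([k]^n)$. Then $$S_r^v(x)=\sum_{k=1}^\infty\frac{(-x)^k}{k!}\frac{\partial^k}{\partial x^k}W_{r,k}^v(-x).$$
   Context: $\mathbb{N}=\{1,2,3,\dots\}$, $\mathbb{N}_0=\mathbb{N}\cup\{0\}$, and $[k]=\{1,\dots,k\}$. The set $[k]^n$ is the set of words $w=w_1\cdots w_n$ of length $n$ with letters in $[k]$, and $\mathcal{S}_n\subset[n]^n$ is the set of permutations of length $n$, i.e. rearrangements of $12\cdots n$. A pattern $v=v_1\cdots v_\ell$ is a word of length $\ell\ge2$ with positive integer letters (possibly repeated). An occurrence of $v$ in a word $w$ of length $n$ is a sequence of indices $1\le j_1<\dots<j_\ell\le n$ such that for all $1\le p,q\le\ell$: $w_{j_p}<w_{j_q}\iff v_p<v_q$, and $w_{j_p}=w_{j_q}\iff v_p=v_q$. Let $\mathrm{occ}_v(w)$ be the number of occurrences of $v$ in $w$ (zero if $w$ is shorter than $v$). For a set $A$ of words, $f_r^v(A)=\#\{w\in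 A:\mathrm{occ}_v(w)=r\}$. Generating functions are understood as formal power series, and $\frac{\partial^k}{\partial x^k}W_{r,k}^v(-x)$ denotes the $k$-th derivative with respect to $x$ of the series $W_{r,k}^v(-x)$ (obtained by substituting $-x$ for $x$ first). *)

theory Defs
  imports Complex_Main
    "HOL-Combinatorics.Multiset_Permutations"
    "HOL-Computational_Algebra.Formal_Power_Series"
begin

definition words :: "nat \<Rightarrow> nat \<Rightarrow> nat list set" where
  "words k n = {w. length w = n \<and> set w \<subseteq> {1..k}}"

abbreviation perms :: "nat \<Rightarrow> nat list set" where
  "perms n \<equiv> permutations_of_set {1..n}"

definition is_pattern :: "nat list \<Rightarrow> bool" where
  "is_pattern v \<longleftrightarrow> length v \<ge> 2 \<and> (\<forall>a\<in>set v. a \<ge> 1)"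

text \<open>An occurrence is a strictly increasing list of positions; since list positions start
  at 0, they are the indices \<open>j\<^sub>1 < \<dots> < j\<^sub>l\<close> shifted down by one.\<close>

definition is_occurrence :: "nat list \<Rightarrow> nat list \<Rightarrow> nat list \<Rightarrow> bool" where
  "is_occurrence v w js \<longleftrightarrow>
     length js = length v \<and> sorted_wrt (<) js \<and> set js \<subseteq> {..<length w} \<and>
     (\<forall>p<length v. \<forall>q<length v.
        (w ! (js ! p) < w ! (js ! q) \<longleftrightarrow> v ! p < v ! q) \<and>
        (w ! (js ! p) = w ! (js ! q) \<longleftrightarrow> v ! p = v ! q))"

definition occ :: "nat list \<Rightarrow> nat list \<Rightarrow> nat" where
  "occ v w = card {js. is_occurrence v w js}"

definition freq :: "nat list \<Rightarrow> nat \<Rightarrow> nat list set \<Rightarrow> nat" where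
  "freq v r A = card {w \<in> A. occ v w = r}"

definition egf_perms :: "nat list \<Rightarrow> nat \<Rightarrow> real fps" where
  "egf_perms v r = Abs_fps (\<lambda>n. if n = 0 then 0 else real (freq v r (perms n)) / fact n)"

definition egf_words :: "nat list \<Rightarrow> nat \<Rightarrow> nat \<Rightarrow> real fps" where
  "egf_words v r k = Abs_fps (\<lambda>n. if n = 0 then 0 else real (freq v r (words k n)) / fact n)"

end

theory Submission
  imports Defs "HOL-Library.Infinite_Set"
begin

text \<open>A permutation of length \<open>n \<ge> 1\<close> is a word of length \<open>n\<close> whose letters are exactly
  \<open>{1..n}\<close>. Since the number of occurrences of a pattern is invariant under order isomorphisms
  of the alphabet, the number of words over a \<open>k\<close>-element alphabet with \<open>r\<close> occurrences depends
  only on \<open>k\<close>, and Moebius inversion over the subsets of \<open>{1..n}\<close> gives the first identity.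
  Dividing it by \<open>n!\<close> gives the coefficients of the second one, as the \<open>k\<close>-th summand has
  coefficient zero at \<open>x\<^sup>n\<close> for \<open>k > n\<close>.\<close>

text \<open>The definition only compares letters of \<open>w\<close> at valid positions. These
  letters lie in \<open>A\<close>, where \<open>h\<close> preserves and reflects both order and
  equality.\<close>

lemma is_occurrence_map:
  assumes mono: "strict_mono_on A h" and w: "set w \<subseteq> (A :: nat set)"
  shows "is_occurrence v (map h w) js \<longleftrightarrow> is_occurrence v w js"
proof -
  have iffs: "map h w ! (js ! p) < map h w ! (js ! q) \<longleftrightarrow> w ! (js ! p) < w ! (js ! q)"
      "map h w ! (js ! p) = map h w ! (js ! q) \<longleftrightarrow> w ! (js ! p) = w ! (js ! q)"
    if "length js = length v" "set js \<subseteq> {..<length w}" "p < length v" "q < length v" for p q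
  proof -
    have less: "js ! p < length w" "js ! q < length w"
      using that nth_mem by (metis lessThan_iff subsetD)+
    then have "w ! (js ! p) \<in> A" "w ! (js ! q) \<in> A"
      using w nth_mem by blast+
    then show "map h w ! (js ! p) < map h w ! (js ! q) \<longleftrightarrow> w ! (js ! p) < w ! (js ! q)"
      "map h w ! (js ! p) = map h w ! (js ! q) \<longleftrightarrow> w ! (js ! p) = w ! (js ! q)"
      using less mono by (simp_all add: strict_mono_on_less strict_mono_on_eq)
  qed
  show ?thesis
    unfolding is_occurrence_def length_map by (intro conj_cong all_cong refl) (simp_all only: iffs)
qed

lemma occ_map:
  assumes "strict_mono_on A h" "set w \<subseteq> A"
  shows "occ v (map h w) = occ v w"
  by (simp add: occ_def is_occurrence_map[OF assms])

lemma freq_words_alphabet: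
  assumes "finite T"
  shows "freq v r {w. length w = n \<and> set w \<subseteq> T} = freq v r (words (card T) n)"
proof -
  obtain g where g: "bij_betw g {..<card T} T" "strict_mono_on {..<card T} g"
    using ex_bij_betw_strict_mono_card[OF assms] by blast
  \<comment> \<open>\<open>g\<close> enumerates \<open>T\<close> increasingly from index 0, whereas
    the letters of \<open>words\<close> start at 1.\<close>
  define h where "h i = g (i - 1)" for i
  have "bij_betw (\<lambda>i. i - 1) {1..card T} {..<card T}"
    by (rule bij_betw_byWitness[where f' = Suc]) auto
  then have bij: "bij_betw h {1..card T} T"
    using bij_betw_trans g(1) unfolding h_def by (fastforce simp: comp_def)
  have mono: "strict_mono_on {1..card T} h"
    by (intro strict_mono_onI) (auto simp: h_def intro!: strict_mono_onD[OF g(2)])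
  have "bij_betw (map h) {w \<in> words (card T) n. occ v w = r}
          {w \<in> {w. length w = n \<and> set w \<subseteq> T}. occ v w = r}"
    unfolding bij_betw_def
  proof
    \<comment> \<open>Injectivity and preimages come from all lists over the alphabets; length and
      \<open>occ v\<close> are kept by \<open>map h\<close>, so the bijection restricts to the two
      sets counted.\<close>
    have lists: "bij_betw (map h) (lists {1..card T}) (lists T)"
      by (rule bij_lists[OF bij])
    show "inj_on (map h) {w \<in> words (card T) n. occ v w = r}"
      using bij_betw_imp_inj_on[OF lists] by (rule inj_on_subset) (auto simp: words_def)
    have "map h w \<in> {w \<in> {w. length w = n \<and> set w \<subseteq> T}. occ v w = r}"
      if "w \<in> {w \<in> words (card T) n. occ v w = r}" for w
      using that occ_map[OF mono, of w v] bij by (auto simp: words_def bij_betw_def)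
    moreover have "u \<in> map h ` {w \<in> words (card T) n. occ v w = r}"
      if u: "u \<in> {w \<in> {w. length w = n \<and> set w \<subseteq> T}. occ v w = r}" for u
    proof -
      have "u \<in> map h ` lists {1..card T}"
        using u bij_betw_imp_surj_on[OF lists] by auto
      then obtain w where w: "u = map h w" "set w \<subseteq> {1..card T}" by auto
      then show ?thesis
        using u occ_map[OF mono w(2), of v] by (auto simp: words_def)
    qed
    ultimately show "map h ` {w \<in> words (card T) n. occ v w = r} =
        {w \<in> {w. length w = n \<and> set w \<subseteq> T}. occ v w = r}" by blast
  qed
  from bij_betw_same_card[OF this] show ?thesis
    unfolding freq_def by (rule sym)
qed

text \<open>Among words with letter set \<open>{1..n}\<close>, having no repeated letter is the same
  as having length \<open>n\<close>. This form depends on the letter set alone, as needed for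
  inversion over subsets.\<close>

lemma perms_eq: "perms n = {w. length w = n \<and> set w = {1..n}}"
proof -
  have "distinct w \<longleftrightarrow> length w = n" if "set w = {1..n}" for w :: "nat list"
    using that distinct_card[of w] card_distinct[of w] by auto
  then show ?thesis
    unfolding permutations_of_set_def by blast
qed

lemma sum_Pow_card:
  fixes f :: "nat \<Rightarrow> 'b::comm_semiring_1"
  assumes "finite A"
  shows "(\<Sum>T\<in>Pow A. f (card T)) = (\<Sum>k\<le>card A. of_nat (card A choose k) * f k)"
proof -
  have "(\<Sum>T\<in>Pow A. f (card T)) = (\<Sum>k\<le>card A. \<Sum>T\<in>{T \<in> Pow A. card T = k}. f (card T))"
    using assms by (intro sum.group[symmetric]) (auto simp: card_mono)
  also have "\<dots> = (\<Sum>k\<le>card A. of_nat (card A choose k) * f k)"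
    using n_subsets[OF assms] by (intro sum.cong) simp_all
  finally show ?thesis .
qed

lemma freq_perms:
  assumes "n \<ge> 1"
  shows "int (freq v r (perms n)) =
    (\<Sum>k=1..n. (-1) ^ (n - k) * int (n choose k) * int (freq v r (words k n)))"
proof -
  define onto where "onto T = int (freq v r {w. length w = n \<and> set w = T})" for T
  define into where "into T = int (freq v r {w. length w = n \<and> set w \<subseteq> T})" for T
  \<comment> \<open>Words over \<open>S\<close> are sorted by their exact letter set; this is the
    relation that Moebius inversion turns around.\<close>
  have "into S = sum onto (Pow S)" if "finite S" for S
  proof -
    have "{w \<in> {w. length w = n \<and> set w \<subseteq> S}. occ v w = r} =
        (\<Union>T\<in>Pow S. {w \<in> {w. length w = n \<and> set w = T}. occ v w = r})" by auto
    moreover have "finite {w \<in> {w. length w = n \<and> set w = T}. occ v w = r}"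
      if "T \<in> Pow S" for T
    proof -
      have "finite T" using that \<open>finite S\<close> finite_subset by blast
      then show ?thesis
        by (rule finite_subset[OF _ finite_lists_length_eq[of T n], rotated]) auto
    qed
    ultimately show ?thesis
      unfolding into_def onto_def freq_def using that
      by (simp only:, subst card_UN_disjoint) auto
  qed
  from inclusion_exclusion_mobius[OF this, of "{1..n}"]
  have "int (freq v r (perms n)) = (\<Sum>T\<in>Pow {1..n}. (-1) ^ (n - card T) * into T)"
    unfolding onto_def perms_eq by simp
  also have "\<dots> = (\<Sum>T\<in>Pow {1..n}. (-1) ^ (n - card T) * int (freq v r (words (card T) n)))"
    by (intro sum.cong refl) (auto simp: into_def freq_words_alphabet finite_subset[of _ "{1..n}"])
  also have "\<dots> = (\<Sum>k\<le>n. int (n choose k) * ((-1) ^ (n - k) * int (freq v r (words k n))))"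
    using sum_Pow_card[of "{1..n}" "\<lambda>k. (-1) ^ (n - k) * int (freq v r (words k n))"] by simp
  also have "\<dots> = (\<Sum>k=1..n. int (n choose k) * ((-1) ^ (n - k) * int (freq v r (words k n))))"
  proof (rule sum.mono_neutral_right)
    \<comment> \<open>The term \<open>k = 0\<close> vanishes because \<open>n \<ge> 1\<close>: no
      nonempty word exists over the empty alphabet.\<close>
    have "words 0 n = {}" using assms by (auto simp: words_def)
    then show "\<forall>k\<in>{..n} - {1..n}. int (n choose k) * ((-1) ^ (n - k) * int (freq v r (words k n))) = 0"
      by (auto simp: freq_def not_le)
  qed auto
  finally show ?thesis by (simp add: mult_ac)
qed

lemma fps_nth_nth_deriv:
  "fps_nth (fps_nth_deriv k f) n = (fact (n + k) / fact n) * fps_nth (f :: 'a::field_char_0 fps) (n + k)"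
proof (induction k arbitrary: f)
  case (Suc k)
  have "(fact (n + Suc k) :: 'a) = of_nat (n + Suc k) * fact (n + k)" by simp
  then show ?case by (simp add: Suc field_simps del: of_nat_add)
qed simp

text \<open>Multiplying by the \<open>k\<close>-th power of \<open>fps_X\<close> undoes the index
  shift of the \<open>k\<close>-th derivative, so only coefficient \<open>n\<close> of
  \<open>f\<close> survives. The factorials combine to a binomial coefficient; the signs are
  \<open>(-1) ^ k\<close> from the power and \<open>(-1) ^ n\<close> from the substitution.\<close>

lemma fps_nth_alternating_term:
  fixes f :: "'a::field_char_0 fps"
  shows "fps_nth (fps_const (1 / fact k) * (- fps_X) ^ k *
           fps_nth_deriv k (fps_compose f (- fps_X))) n =
         (if k \<le> n then (-1) ^ (n - k) * of_nat (n choose k) * fps_nth f n else 0)"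
proof -
  have "(- fps_X :: 'a fps) ^ k = fps_const ((-1) ^ k) * fps_X ^ k"
    unfolding power_minus[of fps_X] by (simp flip: fps_const_power fps_const_neg)
  then have "fps_nth (fps_const (1 / fact k) * (- fps_X) ^ k *
        fps_nth_deriv k (fps_compose f (- fps_X))) n =
      (-1) ^ k / fact k * fps_nth (fps_X ^ k * fps_nth_deriv k (fps_compose f (- fps_X))) n"
    by (simp add: mult.assoc)
  also have "\<dots> = (if k \<le> n then (-1) ^ k / fact k * (fact n / fact (n - k) * ((-1) ^ n * fps_nth f n)) else 0)"
    by (simp add: fps_X_power_mult_nth fps_nth_nth_deriv fps_compose_uminus')
  also have "\<dots> = (if k \<le> n then ((-1) ^ k * (-1) ^ n) * of_nat (n choose k) * fps_nth f n else 0)"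
    by (simp add: binomial_fact)
  also have "\<dots> = (if k \<le> n then (-1) ^ (n - k) * of_nat (n choose k) * fps_nth f n else 0)"
    \<comment> \<open>For \<open>k \<le> n\<close>, the exponents \<open>k + n\<close> and
      \<open>n - k\<close> have the same parity.\<close>
    using neg_one_power_add_eq_neg_one_power_diff[of k n] by (auto simp: add.commute simp flip: power_add)
  finally show ?thesis .
qed

text \<open>Formal power series converge if each coefficient is eventually constant; here
  coefficient \<open>n\<close> of the partial sums is constant from \<open>N = n\<close> on.\<close>

lemma fps_sumsI:
  assumes "\<And>n j. j \<ge> n \<Longrightarrow> fps_nth (F j) n = 0" and "\<And>n. (\<Sum>j<n. fps_nth (F j) n) = fps_nth f n"
  shows "F sums f"
  unfolding sums_def
proof (rule tendsto_fpsI)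
  fix n
  have "fps_nth (\<Sum>j<N. F j) n = fps_nth f n" if "N \<ge> n" for N
    unfolding fps_sum_nth assms(2)[symmetric]
    using that assms(1) by (intro sum.mono_neutral_right) auto
  then show "\<forall>\<^sub>F N in sequentially. fps_nth (\<Sum>j<N. F j) n = fps_nth f n"
    unfolding eventually_sequentially by blast
qed

theorem theorem2:
  fixes v :: "nat list" and r :: nat
  assumes "is_pattern v"
  shows "(\<forall>n\<ge>1. int (freq v r (perms n)) =
            (\<Sum>k=1..n. (-1) ^ (n - k) * int (n choose k) * int (freq v r (words k n)))) \<and>
         (\<lambda>j. let k = Suc j in
            fps_const (1 / fact k) * (- fps_X) ^ k *
              fps_nth_deriv k (fps_compose (egf_words v r k) (- fps_X)))
           sums egf_perms v r"
proof (intro conjI allI impI fps_sumsI, goal_cases)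
  case (1 n)
  then show ?case by (rule freq_perms)
next
  case (2 n j)
  \<comment> \<open>The summand at index \<open>j\<close> belongs to \<open>k = Suc j\<close>, so
    \<open>j \<ge> n\<close> means \<open>k > n\<close>.\<close>
  then show ?case unfolding Let_def fps_nth_alternating_term by simp
next
  case (3 n)
  show ?case
  \<comment> \<open>At \<open>n = 0\<close> the sum is empty and \<open>egf_perms\<close> has
    constant coefficient 0. Otherwise the integer identity is cast to the reals, reindexed by
    \<open>k = Suc j\<close> and divided by \<open>fact n\<close>.\<close>
  proof (cases "n = 0")
    case False
    have "real (freq v r (perms n)) = real_of_int (int (freq v r (perms n)))" by simp
    also have "\<dots> = (\<Sum>k=1..n. (-1) ^ (n - k) * real (n choose k) * real (freq v r (words k n)))"
      using False by (subst freq_perms) simp_all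
    also have "\<dots> = (\<Sum>j<n. (-1) ^ (n - Suc j) * real (n choose Suc j) * real (freq v r (words (Suc j) n)))"
      by (simp add: sum.atLeast1_atMost_eq)
    finally show ?thesis
      unfolding Let_def fps_nth_alternating_term
      using False by (simp add: egf_perms_def egf_words_def sum_divide_distrib)
  qed (simp add: egf_perms_def)
qed

end
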